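(* Let $d\ge 2$, let $G$ be a $d$-uniform hypergraph and let $0<\epsilon<1$. Put $\lambda=\frac{\epsilon}{6}$ and let $\beta\ge \frac{8d^2}{d-1}\cdot\lambda^{-3}$. Let $H$ be an $\mathrm{HEDCS}(G,\beta,\beta(1-\lambda))$. Then $H$ contains an $\epsilon$-restricted fractional matching $M_f^H$ (i.e. one supported on the hyperedges of $H$) with total value at least $$\mu(G)\left(\frac{d}{d^2-d+1}-\frac{\epsilon}{d-1}\right).$$
   Context: A (finite) hypergraph is $d$-uniform if every hyperedge is a set of exactly $d$ vertices. A matching is a set of pairwise disjoint hyperedges; $\mu(G)$ is the maximum cardinality of a matching of $G$. $d_H(v)$ is the number of hyperedges of $H$ containing $v$. HEDCS (hyperedge degree constrained subgraph): for a hypergraph $G=(V,E)$ and parameters $\beta\ge\beta^-\ge0$, a subgraph $H=(V,E_H)$ of $G$ ($E_H\subseteq E$) is an $\mathrm{HEDCS}(G,\beta,\beta^-)$ if (P1) every hyperedge $e\in E_H$ satisfies $\sum_{v\in e}d_H(v)\le\beta$, and (P2) every hyperedge $e\in E\setminus E_H$ satisfies $\sum_{v\in e}d_H(v)\ge\beta^-$. A fractional matching of a hypergraph is a map $y$ from its hyperedges to $[0,1]$ such that for every vertex $v$, $\sum_{e\ni v}y_e\le1$; its value is $\sum_e y_e$. It is $\epsilon$-restricted if for every hyperedge $e$, $y_e=1$ or $y_e\in[0,\epsilon]$. *)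

theory Defs
  imports Complex_Main "HOL-Library.Disjoint_Sets"
begin

text \<open>A hypergraph is given by its vertex set \<open>V\<close> and its set \<open>E\<close> of hyperedges;
  in particular there are no repeated hyperedges.\<close>

definition hypergraph :: "'a set \<Rightarrow> 'a set set \<Rightarrow> bool" where
  "hypergraph V E \<longleftrightarrow> finite V \<and> E \<subseteq> Pow V"

definition uniform_hypergraph :: "nat \<Rightarrow> 'a set \<Rightarrow> 'a set set \<Rightarrow> bool" where
  "uniform_hypergraph d V E \<longleftrightarrow> hypergraph V E \<and> (\<forall>e\<in>E. card e = d)"

definition hmatching :: "'a set set \<Rightarrow> 'a set set \<Rightarrow> bool" where
  "hmatching E M \<longleftrightarrow> M \<subseteq> E \<and> disjoint M"

text \<open>The maximum below is meaningful because \<open>E\<close> is finite for every hypergraph as above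
  and the empty set is a matching.\<close>

definition matching_number :: "'a set set \<Rightarrow> nat" where
  "matching_number E = Max {card M | M. hmatching E M}"

definition hdegree :: "'a set set \<Rightarrow> 'a \<Rightarrow> nat" where
  "hdegree E v = card {e \<in> E. v \<in> e}"

definition hedcs :: "'a set set \<Rightarrow> real \<Rightarrow> real \<Rightarrow> 'a set set \<Rightarrow> bool" where
  "hedcs E \<beta> \<beta>m EH \<longleftrightarrow>
     \<beta> \<ge> \<beta>m \<and> \<beta>m \<ge> 0 \<and> EH \<subseteq> E \<and>
     (\<forall>e\<in>EH. real (\<Sum>v\<in>e. hdegree EH v) \<le> \<beta>) \<and>
     (\<forall>e\<in>E - EH. real (\<Sum>v\<in>e. hdegree EH v) \<ge> \<beta>m)"

text \<open>Fractional matchings are total functions of which only the values on \<open>E\<close> matter.\<close>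

definition fractional_matching :: "'a set \<Rightarrow> 'a set set \<Rightarrow> ('a set \<Rightarrow> real) \<Rightarrow> bool" where
  "fractional_matching V E y \<longleftrightarrow>
     (\<forall>e\<in>E. y e \<in> {0..1}) \<and> (\<forall>v\<in>V. (\<Sum>e | e \<in> E \<and> v \<in> e. y e) \<le> 1)"

definition fm_value :: "'a set set \<Rightarrow> ('a set \<Rightarrow> real) \<Rightarrow> real" where
  "fm_value E y = (\<Sum>e\<in>E. y e)"

definition restricted :: "real \<Rightarrow> 'a set set \<Rightarrow> ('a set \<Rightarrow> real) \<Rightarrow> bool" where
  "restricted \<epsilon> E y \<longleftrightarrow> (\<forall>e\<in>E. y e = 1 \<or> y e \<in> {0..\<epsilon>})"

end

theory Submission
  imports Defs
begin

text \<open>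
  Let \<open>M\<close> be a maximum matching of \<open>G\<close>, let \<open>A\<close> be the set of vertices covered by \<open>M - EH\<close> and \<open>C\<close> the
  set of those covered by \<open>M \<inter> EH\<close>. By (P2), the degrees in \<open>H\<close> of the vertices of an edge of
  \<open>M - EH\<close> add up to almost \<open>\<beta>\<close>, and by (P1) an edge of \<open>H\<close> that meets \<open>A\<close> has little degree left
  for its other vertices, so it can carry much weight.

  For \<open>d \<ge> 3\<close> one of two fractional matchings is good enough: the one giving each edge the inverse
  of its maximal vertex degree, and the one giving \<open>1\<close> to \<open>M \<inter> EH\<close> and the same inverse to the edges
  disjoint from \<open>C\<close>. The average of their values with weights \<open>1 - s\<close> and \<open>s = 2 / d\<close> is
  bounded below edge by edge.

  For \<open>d = 2\<close> this fails. There a random subset \<open>S\<close> of \<open>M \<inter> EH\<close> containing each edge with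
  probability \<open>2 / 3\<close> gets the value \<open>1\<close>, the edges meeting \<open>C\<close> but not \<open>\<Union>S\<close> are scaled up by \<open>3\<close>
  to compensate for the edges lost, and the excess at the vertices of \<open>A\<close> is cut off. Since an edge
  meeting both \<open>A\<close> and \<open>C\<close> is determined by its end in \<open>C\<close> once the one in \<open>A\<close> is fixed, the load at a
  vertex of \<open>A\<close> has small variance and little is cut off.
\<close>

section \<open>Double counting, elementary inequalities and derandomization\<close>

lemma sum_incidence_swap:
  fixes g :: "'a set \<Rightarrow> 'a \<Rightarrow> real"
  assumes "finite F" "finite X"
  shows "(\<Sum>f\<in>F. \<Sum>v\<in>f \<inter> X. g f v) = (\<Sum>v\<in>X. \<Sum>f | f \<in> F \<and> v \<in> f. g f v)"
proof -
  have "(\<Sum>f\<in>F. \<Sum>v\<in>f \<inter> X. g f v) = (\<Sum>f\<in>F. \<Sum>v | v \<in> X \<and> v \<in> f. g f v)"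
    by (intro sum.cong) auto
  also have "\<dots> = (\<Sum>v\<in>X. \<Sum>f | f \<in> F \<and> v \<in> f. g f v)"
    using assms by (intro sum.swap_restrict)
  finally show ?thesis .
qed

text \<open>AM-GM for \<open>b\<close> and \<open>G * t\<^sup>2\<close>: by the relation between
  \<open>b\<close>, \<open>G\<close> and \<open>s\<close>, their geometric mean is half the absolute
  value of \<open>s * t\<close>.\<close>

lemma linear_le_quadratic:
  fixes s b G t :: real
  assumes "b \<ge> 0" "G \<ge> 0" "4 * b * G = s\<^sup>2"
  shows "s * t \<le> b + G * t\<^sup>2"
proof (rule power2_le_imp_le)
  have "(s * t)\<^sup>2 = 4 * b * (G * t\<^sup>2)"
    using assms(3) by (simp add: power_mult_distrib)
  also have "\<dots> = (b + G * t\<^sup>2)\<^sup>2 - (b - G * t\<^sup>2)\<^sup>2"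
    by (simp only: power2_eq_square) (simp add: algebra_simps)
  also have "\<dots> \<le> (b + G * t\<^sup>2)\<^sup>2" by simp
  finally show "(s * t)\<^sup>2 \<le> (b + G * t\<^sup>2)\<^sup>2" .
qed (use assms in simp)

text \<open>Bounds the loss caused by cutting \<open>x\<close> off at \<open>y\<close>. The loss is
  at most the distance of \<open>x\<close> and \<open>y\<close>, which AM-GM replaces by a
  quadratic, so that in expectation a variance appears.\<close>

lemma min_quadratic_lower_bound:
  fixes x y t :: real
  assumes "t > 0"
  shows "min x y \<ge> y - ((x - y)\<^sup>2 / (4 * t) + t)"
proof -
  have "0 \<le> (\<bar>x - y\<bar> - 2 * t)\<^sup>2" by simp
  then have "4 * t * \<bar>x - y\<bar> \<le> (x - y)\<^sup>2 + 4 * t * t"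
    by (simp add: power2_diff power2_eq_square algebra_simps)
  then have "\<bar>x - y\<bar> \<le> (x - y)\<^sup>2 / (4 * t) + t"
    using assms by (simp add: field_simps)
  then show ?thesis by linarith
qed

text \<open>The right-hand side is the expectation of the left-hand side when every element of \<open>I\<close> is
  put into \<open>S\<close> independently with probability \<open>p\<close>; the induction is the method of conditional
  expectations.\<close>

lemma exists_subset_le_expectation:
  fixes a :: "'i \<Rightarrow> real" and c :: "'u \<Rightarrow> 'i \<Rightarrow> real" and w z :: "'u \<Rightarrow> real"
  assumes "finite I" "finite U" "0 \<le> p" "p \<le> 1"
  shows "\<exists>S\<subseteq>I. (\<Sum>i\<in>S. a i) + (\<Sum>u\<in>U. w u * (z u + (\<Sum>i\<in>I. c u i * (of_bool (i \<in> S) - p)))\<^sup>2)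
           \<le> p * (\<Sum>i\<in>I. a i) + (\<Sum>u\<in>U. w u * ((z u)\<^sup>2 + p * (1 - p) * (\<Sum>i\<in>I. (c u i)\<^sup>2)))"
  using assms(1)
proof (induction I arbitrary: z rule: finite_induct)
  case empty
  then show ?case by auto
next
  case (insert j I)
  define R where "R z' = p * (\<Sum>i\<in>I. a i) + (\<Sum>u\<in>U. w u * ((z' u)\<^sup>2 + p * (1 - p) * (\<Sum>i\<in>I. (c u i)\<^sup>2)))"
    for z' :: "'u \<Rightarrow> real"
  \<comment> \<open>\<open>z1\<close> and \<open>z0\<close> absorb the term of \<open>j\<close> into
    the offset, for \<open>j\<close> chosen and not chosen respectively; this is why the induction
    generalizes over \<open>z\<close>.\<close>
  define z1 where "z1 u = z u + c u j * (1 - p)" for u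
  define z0 where "z0 u = z u - c u j * p" for u
  define T where "T = p * (\<Sum>i\<in>insert j I. a i)
    + (\<Sum>u\<in>U. w u * ((z u)\<^sup>2 + p * (1 - p) * (\<Sum>i\<in>insert j I. (c u i)\<^sup>2)))"
  have avg: "p * (a j + R z1) + (1 - p) * R z0 = T"
  proof -
    have "p * (\<Sum>u\<in>U. w u * ((z1 u)\<^sup>2 + p * (1 - p) * (\<Sum>i\<in>I. (c u i)\<^sup>2)))
        + (1 - p) * (\<Sum>u\<in>U. w u * ((z0 u)\<^sup>2 + p * (1 - p) * (\<Sum>i\<in>I. (c u i)\<^sup>2)))
        = (\<Sum>u\<in>U. w u * ((z u)\<^sup>2 + p * (1 - p) * (\<Sum>i\<in>insert j I. (c u i)\<^sup>2)))"
      unfolding sum_distrib_left sum.distrib[symmetric]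
      by (rule sum.cong) (use insert.hyps in \<open>simp_all add: z1_def z0_def power2_eq_square algebra_simps\<close>)
    moreover have "(\<Sum>i\<in>insert j I. a i) = a j + (\<Sum>i\<in>I. a i)"
      using insert.hyps by simp
    ultimately show ?thesis unfolding T_def R_def by (simp add: algebra_simps)
  qed
  have "a j + R z1 \<le> T \<or> R z0 \<le> T"
  proof (rule ccontr)
    assume "\<not> ?thesis"
    then have "T < a j + R z1" "T < R z0" by auto
    moreover from this have "p * T \<le> p * (a j + R z1)" "(1 - p) * T \<le> (1 - p) * R z0"
      using assms(3,4) by (auto intro!: mult_left_mono)
    moreover have "p * T < p * (a j + R z1) \<or> (1 - p) * T < (1 - p) * R z0"
      using assms(3,4) calculation by (cases "p = 0") (auto simp: mult_less_cancel_left)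
    ultimately show False using avg by (simp add: algebra_simps)
  qed
  then show ?case
  proof
    assume le: "a j + R z1 \<le> T"
    obtain S where S: "S \<subseteq> I" and
      ineq: "(\<Sum>i\<in>S. a i) + (\<Sum>u\<in>U. w u * (z1 u + (\<Sum>i\<in>I. c u i * (of_bool (i \<in> S) - p)))\<^sup>2) \<le> R z1"
      using insert.IH[of z1] unfolding R_def by blast
    have jS: "j \<notin> S" "finite S" using S insert.hyps finite_subset by auto
    have "(\<Sum>i\<in>I. c u i * (of_bool (i \<in> insert j S) - p)) = (\<Sum>i\<in>I. c u i * (of_bool (i \<in> S) - p))" for u
      using insert.hyps by (intro sum.cong) auto
    then have "(\<Sum>i\<in>insert j S. a i)
        + (\<Sum>u\<in>U. w u * (z u + (\<Sum>i\<in>insert j I. c u i * (of_bool (i \<in> insert j S) - p)))\<^sup>2) \<le> T"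
      using ineq le jS insert.hyps by (simp add: z1_def add.assoc)
    then show ?thesis using S unfolding T_def by (intro exI[of _ "insert j S"]) auto
  next
    assume le: "R z0 \<le> T"
    obtain S where S: "S \<subseteq> I" and
      ineq: "(\<Sum>i\<in>S. a i) + (\<Sum>u\<in>U. w u * (z0 u + (\<Sum>i\<in>I. c u i * (of_bool (i \<in> S) - p)))\<^sup>2) \<le> R z0"
      using insert.IH[of z0] unfolding R_def by blast
    have "j \<notin> S" using S insert.hyps by auto
    then have "(\<Sum>i\<in>S. a i)
        + (\<Sum>u\<in>U. w u * (z u + (\<Sum>i\<in>insert j I. c u i * (of_bool (i \<in> S) - p)))\<^sup>2) \<le> T"
      using ineq le insert.hyps by (simp add: z0_def algebra_simps)
    then show ?thesis using S unfolding T_def by (intro exI[of _ S]) auto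
  qed
qed

section \<open>The setting: an HEDCS, a matching and vertex degrees\<close>

locale hedcs_with_matching =
  fixes V :: "'a set" and E EH M :: "'a set set" and d :: nat and \<beta> lam :: real
  assumes uniform: "uniform_hypergraph d V E"
    and d_pos: "d > 0"
    and hedcs: "hedcs E \<beta> (\<beta> * (1 - lam)) EH"
    and matching: "hmatching E M"
    and \<beta>_pos: "\<beta> > 0"
begin

definition D :: "'a \<Rightarrow> real" where "D v = real (hdegree EH v)"
definition A :: "'a set" where "A = \<Union>(M - EH)"
definition C :: "'a set" where "C = \<Union>(M \<inter> EH)"

lemma finite_V: "finite V"
  using uniform by (simp add: uniform_hypergraph_def hypergraph_def)

lemma edge_subset: "e \<in> E \<Longrightarrow> e \<subseteq> V"
  using uniform by (auto simp: uniform_hypergraph_def hypergraph_def)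

lemma card_edge: "e \<in> E \<Longrightarrow> card e = d"
  using uniform by (auto simp: uniform_hypergraph_def)

lemma finite_edge: "e \<in> E \<Longrightarrow> finite e"
  using edge_subset finite_V finite_subset by blast

lemma edge_nonempty: "e \<in> E \<Longrightarrow> e \<noteq> {}"
  using card_edge d_pos by fastforce

lemma finite_E: "finite E"
  using uniform finite_V by (auto simp: uniform_hypergraph_def hypergraph_def intro: finite_subset)

lemma EH_subset: "EH \<subseteq> E"
  using hedcs by (simp add: hedcs_def)

lemma finite_EH: "finite EH"
  using EH_subset finite_E finite_subset by blast

lemma M_subset: "M \<subseteq> E"
  using matching by (simp add: hmatching_def)

lemma finite_M: "finite M"
  using M_subset finite_E finite_subset by blast

lemma M_disjoint: "e \<in> M \<Longrightarrow> e' \<in> M \<Longrightarrow> e \<noteq> e' \<Longrightarrow> e \<inter> e' = {}"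
  using matching by (auto simp: hmatching_def disjoint_def)

lemma card_M: "card M = card (M \<inter> EH) + card (M - EH)"
  using card_Int_Diff[OF finite_M] .

lemma A_subset: "A \<subseteq> V" and C_subset: "C \<subseteq> V"
  using M_subset edge_subset by (auto simp: A_def C_def)

lemma finite_A: "finite A" and finite_C: "finite C"
  using A_subset C_subset finite_V finite_subset by blast+

lemma A_C_disjoint: "A \<inter> C = {}"
  using M_disjoint unfolding A_def C_def by blast

lemma card_Union_matching:
  assumes "N \<subseteq> M"
  shows "card (\<Union>N) = d * card N"
proof -
  have "card (\<Union>N) = (\<Sum>e\<in>N. card e)"
  proof (rule card_Union_disjoint)
    show "pairwise disjnt N"
      using assms M_disjoint unfolding pairwise_def disjnt_def by blast
  qed (use assms M_subset finite_edge in blast)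
  also have "\<dots> = (\<Sum>e\<in>N. d)"
    using assms M_subset card_edge by (intro sum.cong) auto
  finally show ?thesis by simp
qed

lemma sum_A: "(\<Sum>v\<in>A. g v) = (\<Sum>e\<in>M - EH. \<Sum>v\<in>e. g v)" for g :: "'a \<Rightarrow> real"
  unfolding A_def using M_disjoint M_subset finite_edge
  by (subst sum.Union_disjoint) auto

lemma D_eq: "D v = real (card {f \<in> EH. v \<in> f})"
  by (simp add: D_def hdegree_def)

lemma D_nonneg: "D v \<ge> 0"
  by (simp add: D_def)

lemma D_ge_1:
  assumes "f \<in> EH" "v \<in> f"
  shows "D v \<ge> 1"
proof -
  have "card {f \<in> EH. v \<in> f} > 0"
    using assms finite_EH by (subst card_gt_0_iff) auto
  then show ?thesis by (simp add: D_eq)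
qed

lemma sum_D_le: "f \<in> EH \<Longrightarrow> (\<Sum>v\<in>f. D v) \<le> \<beta>"
  using hedcs by (simp add: hedcs_def D_def)

lemma sum_D_ge: "e \<in> M - EH \<Longrightarrow> (\<Sum>v\<in>e. D v) \<ge> \<beta> * (1 - lam)"
  using hedcs M_subset by (auto simp: hedcs_def D_def)

lemma D_le:
  assumes "f \<in> EH" "v \<in> f"
  shows "D v \<le> \<beta>"
proof -
  have "D v \<le> (\<Sum>v\<in>f. D v)"
    using assms EH_subset finite_edge D_nonneg by (intro member_le_sum) auto
  then show ?thesis using sum_D_le[OF assms(1)] by linarith
qed

lemma D_le_\<beta>: "D v \<le> \<beta>"
proof (cases "{f \<in> EH. v \<in> f} = {}")
  case True
  then show ?thesis using \<beta>_pos unfolding D_eq True by simp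
next
  case False
  then show ?thesis using D_le by blast
qed

text \<open>There are exactly \<open>D v\<close> edges at \<open>v\<close>; if there are none, the
  sum is empty.\<close>

lemma load_le_1:
  assumes "\<And>f. f \<in> EH \<Longrightarrow> v \<in> f \<Longrightarrow> y f \<le> 1 / D v"
  shows "(\<Sum>f | f \<in> EH \<and> v \<in> f. y f) \<le> 1"
proof -
  have "(\<Sum>f | f \<in> EH \<and> v \<in> f. y f) \<le> (\<Sum>f | f \<in> EH \<and> v \<in> f. 1 / D v)"
    using assms by (intro sum_mono) auto
  also have "\<dots> \<le> 1" by (simp add: D_eq)
  finally show ?thesis .
qed

lemma load_le_1_if_unit_edge:
  assumes "e \<in> EH" "v \<in> e" "y e = 1" "\<And>f. f \<in> EH \<Longrightarrow> v \<in> f \<Longrightarrow> f \<noteq> e \<Longrightarrow> y f = 0"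
  shows "(\<Sum>f | f \<in> EH \<and> v \<in> f. y f) \<le> (1::real)"
proof -
  have "(\<Sum>f | f \<in> EH \<and> v \<in> f. y f) = (\<Sum>f\<in>{e}. y f)"
    using assms finite_EH by (intro sum.mono_neutral_right) auto
  then show ?thesis using assms by simp
qed

section \<open>Uniformity at least 3: averaging two fractional matchings\<close>

text \<open>Besides the weight \<open>1 / maxdeg f\<close> of \<open>f\<close>, the inequality contains the share
  \<open>s / \<beta> - b / D v\<close> of every vertex \<open>v\<close> of \<open>f\<close> in \<open>A\<close> and the share \<open>- b / D v\<close> of every one in \<open>C\<close>.
  The first is at most \<open>G * D v / \<beta>\<^sup>2\<close> by the inequality of the arithmetic and geometric means.\<close>

lemma edge_share_bound:
  fixes s b G K :: real
  assumes f: "f \<in> EH" and v0: "v0 \<in> f" "D v0 = K" and max: "\<And>v. v \<in> f \<Longrightarrow> D v \<le> K"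
    and s: "0 \<le> s" "s \<le> 1" and b: "b \<ge> 0" and G: "G \<ge> 0" "4 * b * G = s\<^sup>2" "G / 4 \<le> 1 - s + b" and sb: "b \<le> s"
  shows "s / \<beta> * card (f \<inter> A) - b * (\<Sum>v\<in>f \<inter> (A \<union> C). 1 / D v)
    \<le> (if f \<inter> C = {} then 1 else 1 - s) * (1 / K)"
proof -
  define g where "g v = s / \<beta> - b / D v" for v
  have fin: "finite f" using f EH_subset finite_edge by auto
  have pos: "D v > 0" if "v \<in> f" for v using D_ge_1[OF f that] by linarith
  have K: "K > 0" "K \<le> \<beta>" using pos D_le[OF f] v0 by auto
  have amgm: "g v \<le> G * D v / \<beta>\<^sup>2" if "v \<in> f" for v
  proof -
    let ?t = "D v / \<beta>"
    have "s * ?t \<le> b + G * ?t\<^sup>2"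
      using b G by (intro linear_le_quadratic)
    then have "(s * ?t - b) / D v \<le> G * ?t\<^sup>2 / D v"
      using pos[OF that] by (intro divide_right_mono) auto
    moreover have "(s * ?t - b) / D v = g v" "G * ?t\<^sup>2 / D v = G * D v / \<beta>\<^sup>2"
      using pos[OF that] \<beta>_pos by (simp_all add: g_def diff_divide_distrib power2_eq_square)
    ultimately show ?thesis by simp
  qed
  \<comment> \<open>(P1) leaves at most \<open>\<beta> - K\<close> of degree to the vertices other
    than \<open>v0\<close>.\<close>
  have sum_g: "(\<Sum>v\<in>B. g v) \<le> G * (\<beta> - K) / \<beta>\<^sup>2" if "B \<subseteq> f - {v0}" for B
  proof -
    have "(\<Sum>v\<in>B. g v) \<le> (\<Sum>v\<in>B. G * D v / \<beta>\<^sup>2)"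
      using amgm that by (intro sum_mono) auto
    also have "\<dots> = G / \<beta>\<^sup>2 * (\<Sum>v\<in>B. D v)"
      by (simp add: sum_distrib_left)
    also have "(\<Sum>v\<in>B. D v) \<le> (\<Sum>v\<in>f - {v0}. D v)"
      using that fin D_nonneg by (intro sum_mono2) auto
    also have "(\<Sum>v\<in>f - {v0}. D v) \<le> \<beta> - K"
      using sum_D_le[OF f] sum.remove[OF fin v0(1), of D] v0(2) by linarith
    finally show ?thesis using G by (simp add: mult_left_mono divide_right_mono)
  qed
  \<comment> \<open>As \<open>(\<beta> - K) * K\<close> is at most
    \<open>\<beta>\<^sup>2 / 4\<close>, this reduces to the hypothesis on
    \<open>G / 4\<close>.\<close>
  have Q: "G * (\<beta> - K) / \<beta>\<^sup>2 \<le> (1 - s + b) / K"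
  proof -
    have "0 \<le> (\<beta> - 2 * K)\<^sup>2" by simp
    then have "(\<beta> - K) * K \<le> \<beta>\<^sup>2 / 4" by (simp add: power2_eq_square algebra_simps)
    then have "G * ((\<beta> - K) * K) \<le> G * (\<beta>\<^sup>2 / 4)" using G by (intro mult_left_mono)
    also have "\<dots> \<le> (1 - s + b) * \<beta>\<^sup>2"
      using G(3) mult_right_mono[of "G / 4" "1 - s + b" "\<beta>\<^sup>2"] by simp
    finally show ?thesis using K \<beta>_pos by (simp add: field_simps)
  qed
  have split: "s / \<beta> * card (f \<inter> A) - b * (\<Sum>v\<in>f \<inter> (A \<union> C). 1 / D v)
      = (\<Sum>v\<in>f \<inter> A. g v) - b * (\<Sum>v\<in>f \<inter> C. 1 / D v)"
  proof -
    have "(\<Sum>v\<in>f \<inter> (A \<union> C). 1 / D v) = (\<Sum>v\<in>f \<inter> A. 1 / D v) + (\<Sum>v\<in>f \<inter> C. 1 / D v)"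
      using fin A_C_disjoint by (subst sum.union_disjoint[symmetric]) (auto simp: Int_Un_distrib)
    then show ?thesis by (simp add: g_def sum_subtractf sum_distrib_left algebra_simps)
  qed
  show ?thesis
  proof (cases "f \<inter> C = {}")
    case True
    have "(\<Sum>v\<in>f \<inter> A. g v) \<le> 1 / K"
    proof (cases "v0 \<in> A")
      case v0A: True
      then have "(\<Sum>v\<in>f \<inter> A. g v) = g v0 + (\<Sum>v\<in>f \<inter> A - {v0}. g v)"
        using fin v0 by (intro sum.remove) auto
      \<comment> \<open>\<open>v0\<close> contributes at most \<open>(s - b) / K\<close> since
        \<open>K \<le> \<beta>\<close>, and the other vertices at most
        \<open>(1 - s + b) / K\<close>. These add up to exactly \<open>1 / K\<close>.\<close>
      also have "\<dots> \<le> (s / K - b / K) + (1 - s + b) / K"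
      proof (intro add_mono)
        show "g v0 \<le> s / K - b / K"
          using K s v0 \<beta>_pos by (simp add: g_def frac_le)
        show "(\<Sum>v\<in>f \<inter> A - {v0}. g v) \<le> (1 - s + b) / K"
          by (intro order_trans[OF sum_g Q]) auto
      qed
      also have "\<dots> = 1 / K" by (simp add: diff_divide_distrib add_divide_distrib)
      finally show ?thesis .
    next
      case False
      then have "(\<Sum>v\<in>f \<inter> A. g v) \<le> G * (\<beta> - K) / \<beta>\<^sup>2" by (intro sum_g) auto
      also have "\<dots> \<le> 1 / K"
      proof -
        have "0 \<le> (\<beta> - 2 * K)\<^sup>2" by simp
        then have "(\<beta> - K) * K \<le> \<beta>\<^sup>2 / 4" by (simp add: power2_eq_square algebra_simps)
        then have "G * ((\<beta> - K) * K) \<le> G * (\<beta>\<^sup>2 / 4)" using G by (intro mult_left_mono)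
        also have "\<dots> \<le> 1 * \<beta>\<^sup>2"
          using G(3) sb mult_right_mono[of "G / 4" 1 "\<beta>\<^sup>2"] by simp
        finally show ?thesis using K \<beta>_pos by (simp add: field_simps)
      qed
      finally show ?thesis .
    qed
    then show ?thesis using True split by simp
  next
    case False
    then obtain w0 where w0: "w0 \<in> f" "w0 \<in> C" by auto
    have w0A: "w0 \<notin> A" using w0 A_C_disjoint by auto
    have "1 / D w0 \<le> (\<Sum>v\<in>f \<inter> C. 1 / D v)"
      using w0 fin D_nonneg by (intro member_le_sum) auto
    then have le: "(\<Sum>v\<in>f \<inter> A. g v) - b * (\<Sum>v\<in>f \<inter> C. 1 / D v) \<le> (\<Sum>v\<in>f \<inter> A. g v) - b / D w0"
      using b mult_left_mono by fastforce
    have "(\<Sum>v\<in>f \<inter> A. g v) - b / D w0 \<le> (1 - s + b) / K - b / K"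
    proof (cases "v0 \<in> A")
      case True
      have "(\<Sum>v\<in>f \<inter> A. g v) - b / D w0 = g v0 + (\<Sum>v\<in>f \<inter> A - {v0}. g v) - b / D w0"
        using fin v0 True by (subst sum.remove[of _ v0]) auto
      \<comment> \<open>Exchange: the terms \<open>s / \<beta>\<close> of \<open>v0\<close> and
        \<open>- b / D w0\<close> are regrouped into the share \<open>g w0\<close>, which leaves
        \<open>- b / K\<close>. The new index set avoids \<open>v0\<close>, so that
        \<open>sum_g\<close> applies.\<close>
      also have "\<dots> = (\<Sum>v\<in>insert w0 (f \<inter> A - {v0}). g v) - b / K"
        using fin w0A v0 by (simp add: g_def)
      also have "\<dots> \<le> (1 - s + b) / K - b / K"
        by (intro diff_right_mono order_trans[OF sum_g Q]) (use w0 w0A True in auto)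
      finally show ?thesis .
    next
      case False
      then have "(\<Sum>v\<in>f \<inter> A. g v) \<le> (1 - s + b) / K"
        by (intro order_trans[OF sum_g Q]) auto
      moreover have "b / K \<le> b / D w0"
        using b pos w0 max by (intro divide_left_mono) (auto simp: K)
      ultimately show ?thesis by linarith
    qed
    then show ?thesis using le split False by (simp add: diff_divide_distrib add_divide_distrib)
  qed
qed

text \<open>Each vertex of \<open>A \<union> C\<close> collects at most 1 from its edges, and
  \<open>A \<union> C\<close> consists of the \<open>d * card M\<close> vertices covered by
  \<open>M\<close>.\<close>

lemma sum_A_C_inverse_degree:
  "(\<Sum>f\<in>EH. \<Sum>v\<in>f \<inter> (A \<union> C). 1 / D v) \<le> real d * card M"
proof -
  have "(\<Sum>f\<in>EH. \<Sum>v\<in>f \<inter> (A \<union> C). 1 / D v) = (\<Sum>v\<in>A \<union> C. \<Sum>f | f \<in> EH \<and> v \<in> f. 1 / D v)"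
    using finite_EH finite_A finite_C by (intro sum_incidence_swap) auto
  also have "\<dots> \<le> (\<Sum>v\<in>A \<union> C. 1)"
    by (intro sum_mono load_le_1) auto
  also have "\<dots> = real (card (\<Union>M))"
    by (simp add: A_def C_def flip: Union_Un_distrib) (metis Int_Diff_Un Un_commute)
  finally show ?thesis using card_Union_matching[of M] by simp
qed

text \<open>Both sides are compared with the degree sum over \<open>A\<close>: (P2) bounds it from
  below on each edge of \<open>M - EH\<close>, and double counting turns it into the left-hand
  side.\<close>

lemma sum_A_degree:
  "(\<Sum>f\<in>EH. real (card (f \<inter> A))) \<ge> card (M - EH) * (\<beta> * (1 - lam))"
proof -
  have "card (M - EH) * (\<beta> * (1 - lam)) = (\<Sum>e\<in>M - EH. \<beta> * (1 - lam))" by simp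
  also have "\<dots> \<le> (\<Sum>e\<in>M - EH. \<Sum>v\<in>e. D v)" using sum_D_ge by (intro sum_mono)
  also have "\<dots> = (\<Sum>v\<in>A. \<Sum>f | f \<in> EH \<and> v \<in> f. 1)" by (simp add: sum_A D_eq)
  also have "\<dots> = (\<Sum>f\<in>EH. \<Sum>v\<in>f \<inter> A. 1)"
    using finite_EH finite_A by (intro sum_incidence_swap[symmetric])
  finally show ?thesis by simp
qed

text \<open>Summing \<open>edge_share_bound\<close> over \<open>EH\<close> bounds the average of the
  two values from below, and the larger value is at least the average. The condition
  \<open>s \<le> b * \<beta> * \<epsilon>\<close> deals with the edges of small maximal
  degree.\<close>

lemma exists_restricted_of_share_bound:
  fixes s b G \<epsilon> :: real
  assumes s: "0 \<le> s" "s \<le> 1" and b: "b \<ge> 0" and G: "G \<ge> 0" "4 * b * G = s\<^sup>2" "G / 4 \<le> 1 - s + b" and sb: "b \<le> s"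
    and \<epsilon>: "\<epsilon> > 0" "s \<le> b * \<beta> * \<epsilon>"
  shows "\<exists>y. fractional_matching V EH y \<and> restricted \<epsilon> EH y \<and>
    fm_value EH y \<ge> s * card M - b * real d * card M - s * lam * card (M - EH)"
proof -
  define mx where "mx f = Max (D ` f)" for f
  \<comment> \<open>If the maximal degree is below \<open>1 / \<epsilon>\<close>, its inverse
    exceeds \<open>\<epsilon>\<close>; such an edge gets 0 to keep \<open>y0\<close>
    restricted.\<close>
  define y0 where "y0 f = (if mx f \<ge> 1 / \<epsilon> then 1 / mx f else 0)" for f
  define y1 where "y1 f = (if f \<in> M then 1 else if f \<inter> C = {} then y0 f else 0)" for f
  have fin: "finite f" "f \<noteq> {}" if "f \<in> EH" for f
    using that EH_subset finite_edge edge_nonempty by auto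
  have D_le_mx: "D v \<le> mx f" if "f \<in> EH" "v \<in> f" for f v
    unfolding mx_def using fin that by (intro Max_ge) auto
  have mx_attained: "\<exists>v\<in>f. D v = mx f" if "f \<in> EH" for f
    using Max_in[of "D ` f"] fin[OF that] unfolding mx_def by (auto simp: image_iff)
  have mx_ge: "mx f \<ge> 1" if "f \<in> EH" for f
    using mx_attained[OF that] D_ge_1[OF that] by metis
  have y0: "0 \<le> y0 f" "y0 f \<le> 1" "y0 f \<le> \<epsilon>" if "f \<in> EH" for f
    using mx_ge[OF that] \<epsilon>(1) by (auto simp: y0_def field_simps)
  have y0_le: "y0 f \<le> 1 / D v" if "f \<in> EH" "v \<in> f" for f v
    using D_le_mx[OF that] D_ge_1[OF that] by (auto simp: y0_def frac_le)
  have y1: "0 \<le> y1 f" "y1 f \<le> 1" "y1 f = 1 \<or> y1 f \<le> \<epsilon>" if "f \<in> EH" for f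
    using y0[OF that] \<epsilon>(1) by (auto simp: y1_def)
  have fm0: "fractional_matching V EH y0"
    unfolding fractional_matching_def using y0 y0_le load_le_1 by auto
  have r0: "restricted \<epsilon> EH y0" unfolding restricted_def using y0 by auto
  have load1: "(\<Sum>f | f \<in> EH \<and> v \<in> f. y1 f) \<le> 1" for v
  proof (cases "v \<in> C")
    case True
    then obtain e where e: "e \<in> M" "e \<in> EH" "v \<in> e" by (auto simp: C_def)
    show ?thesis
    proof (rule load_le_1_if_unit_edge[OF e(2,3)])
      fix f assume "f \<in> EH" "v \<in> f" "f \<noteq> e"
      then show "y1 f = 0" using True M_disjoint[OF e(1), of f] e by (auto simp: y1_def)
    qed (use e in \<open>simp add: y1_def\<close>)
  next
    case False
    then show ?thesis
      using y0_le y0 by (intro load_le_1) (auto simp: y1_def C_def D_nonneg)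
  qed
  have fm1: "fractional_matching V EH y1"
    unfolding fractional_matching_def using y1 load1 by auto
  have r1: "restricted \<epsilon> EH y1" unfolding restricted_def using y1 by force
  have share: "s / \<beta> * card (f \<inter> A) - b * (\<Sum>v\<in>f \<inter> (A \<union> C). 1 / D v)
    \<le> (if f \<inter> C = {} then 1 else 1 - s) * y0 f" if f: "f \<in> EH" for f
  proof (cases "mx f \<ge> 1 / \<epsilon>")
    case True
    obtain v0 where "v0 \<in> f" "D v0 = mx f" using mx_attained[OF f] by auto
    then show ?thesis
      using edge_share_bound[OF f _ _ D_le_mx[OF f] s b G sb] True by (simp add: y0_def)
  next
    case False
    \<comment> \<open>On an edge of weight 0 all degrees are below \<open>1 / \<epsilon>\<close>, so
      already the share of each single vertex is at most 0.\<close>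
    have "s / \<beta> \<le> b * (1 / D v)" if v: "v \<in> f" for v
    proof -
      have "D v < 1 / \<epsilon>" using D_le_mx[OF f v] False by linarith
      then have "\<epsilon> < 1 / D v" using \<epsilon> D_ge_1[OF f v] by (simp add: field_simps)
      then have "b * \<epsilon> \<le> b * (1 / D v)" using b by (intro mult_left_mono) auto
      moreover have "s / \<beta> \<le> b * \<epsilon>" using \<epsilon> \<beta>_pos by (simp add: field_simps)
      ultimately show ?thesis by linarith
    qed
    then have "(\<Sum>v\<in>f \<inter> A. s / \<beta>) \<le> (\<Sum>v\<in>f \<inter> A. b * (1 / D v))"
      by (intro sum_mono) auto
    also have "\<dots> \<le> (\<Sum>v\<in>f \<inter> (A \<union> C). b * (1 / D v))"
      using fin[OF f] b D_nonneg by (intro sum_mono2) auto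
    finally show ?thesis using False by (simp add: y0_def sum_distrib_left mult.commute)
  qed
  have value1: "fm_value EH y1 = card (M \<inter> EH) + (\<Sum>f\<in>EH. if f \<inter> C = {} then y0 f else 0)"
  proof -
    have "fm_value EH y1 = (\<Sum>f\<in>EH. of_bool (f \<in> M) + (if f \<inter> C = {} then y0 f else 0))"
      unfolding fm_value_def y1_def using fin by (intro sum.cong) (auto simp: C_def)
    then show ?thesis using finite_EH by (simp add: sum.distrib Int_commute)
  qed
  have avg: "s * fm_value EH y1 + (1 - s) * fm_value EH y0
      = s * card (M \<inter> EH) + (\<Sum>f\<in>EH. (if f \<inter> C = {} then 1 else 1 - s) * y0 f)"
  proof -
    have "s * (\<Sum>f\<in>EH. if f \<inter> C = {} then y0 f else 0) + (1 - s) * (\<Sum>f\<in>EH. y0 f)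
        = (\<Sum>f\<in>EH. (if f \<inter> C = {} then 1 else 1 - s) * y0 f)"
      unfolding sum_distrib_left sum.distrib[symmetric]
      by (intro sum.cong) (auto simp: algebra_simps)
    then show ?thesis unfolding value1 by (simp add: fm_value_def distrib_left)
  qed
  have "s * lam * card (M - EH) + b * (real d * card M) \<ge> b * (real d * card M) - s / \<beta> * (card (M - EH) * (\<beta> * (1 - lam))) + s * card (M - EH)"
    using \<beta>_pos by (simp add: algebra_simps)
  then have "s * card M - b * real d * card M - s * lam * card (M - EH)
      \<le> s * card (M \<inter> EH) + (s / \<beta> * (card (M - EH) * (\<beta> * (1 - lam))) - b * (real d * card M))"
    by (simp add: card_M distrib_left)
  also have "s / \<beta> * (card (M - EH) * (\<beta> * (1 - lam))) - b * (real d * card M)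
      \<le> s / \<beta> * (\<Sum>f\<in>EH. real (card (f \<inter> A))) - b * (\<Sum>f\<in>EH. \<Sum>v\<in>f \<inter> (A \<union> C). 1 / D v)"
    using sum_A_degree sum_A_C_inverse_degree s b \<beta>_pos by (intro diff_mono mult_left_mono) auto
  also have "\<dots> = (\<Sum>f\<in>EH. s / \<beta> * card (f \<inter> A) - b * (\<Sum>v\<in>f \<inter> (A \<union> C). 1 / D v))"
    by (simp add: sum_subtractf sum_distrib_left)
  also have "\<dots> \<le> (\<Sum>f\<in>EH. (if f \<inter> C = {} then 1 else 1 - s) * y0 f)"
    using share by (intro sum_mono)
  also have "s * card (M \<inter> EH) + \<dots> = s * fm_value EH y1 + (1 - s) * fm_value EH y0"
    using avg by simp
  also have "\<dots> \<le> s * max (fm_value EH y1) (fm_value EH y0) + (1 - s) * max (fm_value EH y1) (fm_value EH y0)"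
    using s by (intro add_mono mult_left_mono) auto
  also have "\<dots> = max (fm_value EH y1) (fm_value EH y0)" by (simp add: algebra_simps)
  finally show ?thesis using fm0 fm1 r0 r1 by (cases "fm_value EH y1 \<le> fm_value EH y0") auto
qed

text \<open>Here \<open>b\<close> is chosen such that \<open>s - d * b\<close> is exactly the ratio
  \<open>c\<close> to be reached, and \<open>G\<close> is then forced by
  \<open>4 * b * G = s\<^sup>2\<close>. For \<open>d = 2\<close> these choices would give
  \<open>G / 4 = 3 / 8\<close> but \<open>1 - s + b = 1 / 6\<close>.\<close>

lemma exists_restricted_uniformity_ge_3:
  fixes \<epsilon> :: real
  assumes d: "d \<ge> 3" and \<epsilon>: "0 < \<epsilon>" "\<epsilon> < 1" and lam: "lam = \<epsilon> / 6"
    and \<beta>: "\<beta> \<ge> 8 * (real d)^2 / (real d - 1) * lam powi (-3)"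
  shows "\<exists>y. fractional_matching V EH y \<and> restricted \<epsilon> EH y \<and>
    fm_value EH y \<ge> real (card M) * (real d / ((real d)^2 - real d + 1) - \<epsilon> / (real d - 1))"
proof -
  define c where "c = real d / ((real d)^2 - real d + 1)"
  define h where "h = 2 - real d * c"
  define s where "s = 2 / real d"
  define b where "b = h / (real d)\<^sup>2"
  define G where "G = 1 / h"
  have d3: "real d \<ge> 3" using d by simp
  have den: "(real d)^2 - real d + 1 > 0"
    using mult_right_mono[of 1 "real d" "real d"] d3 unfolding power2_eq_square by linarith
  have h: "h \<ge> 5 / 7" "h \<le> 1"
  proof -
    \<comment> \<open>After clearing denominators, \<open>h \<ge> 5 / 7\<close> is this inequality;
      equality holds at \<open>d = 3\<close>.\<close>
    have "0 \<le> (2 * real d - 3) * (real d - 3)" using d3 by (intro mult_nonneg_nonneg) auto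
    then show "h \<ge> 5 / 7"
      unfolding h_def c_def using den by (simp add: field_simps power2_eq_square)
    show "h \<le> 1"
      unfolding h_def c_def using den d3 by (simp add: field_simps power2_eq_square)
  qed
  have c: "c = s - real d * b"
    using d3 by (simp add: s_def b_def h_def field_simps power2_eq_square)
  have "s \<le> 2 / 3" unfolding s_def using d3 by (intro divide_left_mono) auto
  have "b \<le> s"
    using h d3 mult_mono[of h 1 1 "real d"] by (simp add: s_def b_def field_simps power2_eq_square)
  have "G / 4 \<le> 1 - s + b"
  proof -
    have "G / 4 \<le> 7 / 20" using h by (simp add: G_def field_simps)
    also have "7 / 20 \<le> 1 - s + b"
    \<comment> \<open>For \<open>d = 3\<close>, \<open>1 - s = 1 / 3\<close> falls just short of
      \<open>7 / 20\<close>, and \<open>b\<close> makes up for it.\<close>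
    proof (cases "d = 3")
      case True
      then show ?thesis using h by (simp add: s_def b_def)
    next
      case False
      then have "real d \<ge> 4" using d by simp
      then have "s \<le> 2 / 4" unfolding s_def by (intro divide_left_mono) auto
      moreover have "b \<ge> 0" using h by (simp add: b_def)
      ultimately show ?thesis by simp
    qed
    finally show ?thesis .
  qed
  moreover have "4 * b * G = s\<^sup>2"
    using h by (simp add: b_def G_def s_def power2_eq_square)
  \<comment> \<open>The quotient \<open>s / b = 2 * d / h\<close> is at most
    \<open>14 * d / 5\<close>, far below the bound \<open>1728 * d\<close> obtained for
    \<open>\<beta> * \<epsilon>\<close>.\<close>
  moreover have "s \<le> b * \<beta> * \<epsilon>"
  proof -
    have "lam powi (-3) = 216 / \<epsilon> ^ 3"
      by (simp add: lam power_int_minus field_simps)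
    then have \<beta>': "\<beta> \<ge> 8 * (real d)^2 / (real d - 1) * (216 / \<epsilon> ^ 3)" using \<beta> by simp
    have "8 * real d \<le> 8 * (real d)^2 / (real d - 1)"
      using d3 by (simp add: field_simps power2_eq_square)
    moreover have "216 / \<epsilon> \<le> 216 / \<epsilon> ^ 3"
      using \<epsilon> power_decreasing[of 1 3 \<epsilon>] by (intro divide_left_mono) auto
    ultimately have "8 * real d * (216 / \<epsilon>) \<le> 8 * (real d)^2 / (real d - 1) * (216 / \<epsilon> ^ 3)"
      using d3 \<epsilon> by (intro mult_mono) auto
    then have "8 * real d * (216 / \<epsilon>) \<le> \<beta>" using \<beta>' by linarith
    then have "8 * real d * 216 \<le> \<beta> * \<epsilon>"
      using \<epsilon> by (simp add: field_simps)
    then have "b * (8 * real d * 216) \<le> b * (\<beta> * \<epsilon>)"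
      using h by (intro mult_left_mono) (auto simp: b_def)
    moreover have "b * (8 * real d * 216) \<ge> s"
      using h d3 by (simp add: b_def s_def field_simps power2_eq_square)
    ultimately show ?thesis by simp
  qed
  ultimately obtain y where y: "fractional_matching V EH y" "restricted \<epsilon> EH y" and
    val: "fm_value EH y \<ge> s * card M - b * real d * card M - s * lam * card (M - EH)"
    using exists_restricted_of_share_bound[of s b G \<epsilon>] h \<open>s \<le> 2 / 3\<close> \<open>b \<le> s\<close> \<epsilon>
    by (auto simp: s_def b_def G_def)
  have "s * lam \<le> \<epsilon> / (real d - 1)"
    using d3 \<epsilon> mult_right_mono[of 3 "real d" \<epsilon>] by (simp add: s_def lam field_simps)
  moreover have "real (card (M - EH)) \<le> card M" using card_M by simp
  ultimately have "s * lam * card (M - EH) \<le> \<epsilon> / (real d - 1) * card M"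
    using d3 \<epsilon> by (intro mult_mono) auto
  then have "fm_value EH y \<ge> card M * (c - \<epsilon> / (real d - 1))"
    using val by (simp add: c algebra_simps)
  then show ?thesis using y unfolding c_def by blast
qed

section \<open>Uniformity 2: vertex weights\<close>

text \<open>For \<open>0 < D v < \<beta>\<close> this is the minimum of \<open>1 / D v\<close> and
  \<open>1 / (2 * (\<beta> - D v))\<close>. The first keeps the sum of \<open>\<rho> v\<close> over
  the edges at \<open>v\<close> at most 1. By (P1), the second is at most
  \<open>1 / (2 * D u)\<close> for the other end \<open>u\<close> of any edge at \<open>v\<close>,
  so that \<open>u\<close> can bear even \<open>2 * \<rho> v\<close> from each of its edges.\<close>

definition \<rho> :: "'a \<Rightarrow> real" where
  "\<rho> v = (if D v \<le> 2 * \<beta> / 3 then 1 / (2 * (\<beta> - D v)) else 1 / D v)"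

lemma \<rho>_bounds: "0 \<le> \<rho> v" "2 * \<rho> v \<le> 3 / \<beta>" "\<rho> v * D v \<le> 1"
  using \<beta>_pos D_nonneg[of v] by (auto simp: \<rho>_def field_simps)

lemma \<rho>_le:
  assumes "D v + D u \<le> \<beta>" "D u > 0"
  shows "\<rho> v \<le> 1 / (2 * D u)"
  using assms D_nonneg[of v] \<beta>_pos by (auto simp: \<rho>_def field_simps)

text \<open>With \<open>x = D v / \<beta>\<close>, the left-hand side is the convex function
  \<open>x / (2 * (1 - x))\<close> up to \<open>x = 2 / 3\<close> and 1 beyond. The linear bound is
  the tangent at \<open>x = 1 / 2\<close>.\<close>

lemma \<rho>_tangent: "\<rho> v * D v \<ge> min 1 (2 * (D v / \<beta>) - 1 / 2)"
proof (cases "D v \<le> 2 * \<beta> / 3")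
  case True
  have "0 \<le> (\<beta> - 2 * D v)\<^sup>2" by simp
  then have "2 * (D v / \<beta>) - 1 / 2 \<le> D v / (2 * (\<beta> - D v))"
    using True \<beta>_pos by (simp add: field_simps power2_eq_square)
  then show ?thesis using True by (simp add: \<rho>_def)
next
  case False
  then show ?thesis using \<beta>_pos by (simp add: \<rho>_def)
qed

text \<open>For an edge of \<open>M - EH\<close>, (P2) makes the two tangents add up to at least
  \<open>2 * (1 - lam) - 1\<close>; if one of the minima is 1, that end alone suffices.\<close>

lemma sum_A_\<rho>_D:
  assumes d: "d = 2" and lam: "lam \<ge> 0"
  shows "(\<Sum>v\<in>A. \<rho> v * D v) \<ge> (1 - 2 * lam) * card (M - EH)"
proof -
  have "1 - 2 * lam \<le> (\<Sum>v\<in>e. \<rho> v * D v)" if e: "e \<in> M - EH" for e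
  proof -
    have "card e = 2" using e M_subset card_edge d by auto
    then obtain u v where uv: "e = {u, v}" "u \<noteq> v" by (auto simp: card_2_iff)
    have "D u + D v \<ge> \<beta> * (1 - lam)" using sum_D_ge[OF e] uv by simp
    then have "D u / \<beta> + D v / \<beta> \<ge> 1 - lam"
      using \<beta>_pos by (simp add: field_simps)
    moreover have "0 \<le> \<rho> u * D u" "0 \<le> \<rho> v * D v"
      using \<rho>_bounds D_nonneg by auto
    ultimately show ?thesis
      using \<rho>_tangent[of u] \<rho>_tangent[of v] lam uv by (auto simp: min_def split: if_splits)
  qed
  then have "(\<Sum>e\<in>M - EH. 1 - 2 * lam) \<le> (\<Sum>v\<in>A. \<rho> v * D v)"
    unfolding sum_A by (intro sum_mono)
  then show ?thesis by (simp add: mult.commute)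
qed

lemma sum_\<rho>_other_le:
  assumes "d = 2" "f \<in> EH" "u \<in> f"
  shows "(\<Sum>v\<in>f \<inter> A - {u}. \<rho> v) \<le> 1 / (2 * D u)"
proof -
  have "card f = 2" using assms EH_subset card_edge by auto
  then obtain w where w: "f = {u, w}" "u \<noteq> w"
    using assms(3) by (auto simp: card_2_iff)
  have "D w + D u \<le> \<beta>" using sum_D_le[OF assms(2)] w by simp
  then have "\<rho> w \<le> 1 / (2 * D u)" using D_ge_1[OF assms(2,3)] by (intro \<rho>_le) auto
  moreover have "f \<inter> A - {u} = (if w \<in> A then {w} else {})" using w by auto
  ultimately show ?thesis using D_nonneg by auto
qed

section \<open>Uniformity 2: random choice of edges of the matching\<close>

definition C_edges :: "'a \<Rightarrow> 'a set set" where
  "C_edges v = {f \<in> EH. v \<in> f \<and> f \<inter> C \<noteq> {}}"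

text \<open>For \<open>d = 2\<close> and \<open>v\<close> in \<open>A\<close>, an edge of
  \<open>C_edges v\<close> has its other end in a unique edge of \<open>M \<inter> EH\<close>. It is
  alive iff that edge is not in \<open>S\<close>, in the random model with probability
  \<open>1 / 3\<close>.\<close>

definition alive :: "'a set set \<Rightarrow> 'a \<Rightarrow> 'a set set" where
  "alive S v = {f \<in> C_edges v. f \<inter> \<Union>S = {}}"

lemma finite_C_edges: "finite (C_edges v)"
  using finite_EH by (simp add: C_edges_def)

text \<open>The identity has the form that \<open>exists_subset_le_expectation\<close> expects, and
  the inequality bounds the variance. Every edge of \<open>C_edges v\<close> is
  \<open>{v, w}\<close> with \<open>w\<close> in exactly one \<open>e\<close>; hence each
  \<open>e\<close> accounts for at most two edges, and the counts add up to at most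
  \<open>D v\<close>.\<close>

lemma card_alive_deviation:
  assumes d: "d = 2" and v: "v \<in> A" and S: "S \<subseteq> M \<inter> EH"
  shows "real (card (alive S v)) - card (C_edges v) / 3
    = - (\<Sum>e\<in>M \<inter> EH. card {f \<in> C_edges v. f \<inter> e \<noteq> {}} * (of_bool (e \<in> S) - 2 / 3))"
    and "(\<Sum>e\<in>M \<inter> EH. (real (card {f \<in> C_edges v. f \<inter> e \<noteq> {}}))\<^sup>2) \<le> 2 * D v"
proof -
  let ?c = "\<lambda>e. real (card {f \<in> C_edges v. f \<inter> e \<noteq> {}})"
  have other: "\<exists>w. f = {v, w} \<and> w \<in> C" if "f \<in> C_edges v" for f
  proof -
    have f: "f \<in> EH" "v \<in> f" "f \<inter> C \<noteq> {}" using that by (auto simp: C_edges_def)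
    then have "card f = 2" using EH_subset card_edge d by auto
    then obtain w where "f = {v, w}" using f by (auto simp: card_2_iff)
    then show ?thesis using f v A_C_disjoint by auto
  qed
  have vC: "v \<notin> C" using v A_C_disjoint by auto
  have sum_c: "(\<Sum>e\<in>N. ?c e) = card {f \<in> C_edges v. f \<inter> \<Union>N \<noteq> {}}" if N: "N \<subseteq> M \<inter> EH" for N
  proof -
    have "card (\<Union>e\<in>N. {f \<in> C_edges v. f \<inter> e \<noteq> {}}) = (\<Sum>e\<in>N. card {f \<in> C_edges v. f \<inter> e \<noteq> {}})"
    proof (rule card_UN_disjoint)
      show "finite N" using N finite_M finite_subset by blast
      show "\<forall>e\<in>N. finite {f \<in> C_edges v. f \<inter> e \<noteq> {}}" using finite_C_edges by simp
      show "\<forall>e\<in>N. \<forall>e'\<in>N. e \<noteq> e' \<longrightarrow> {f \<in> C_edges v. f \<inter> e \<noteq> {}} \<inter> {f \<in> C_edges v. f \<inter> e' \<noteq> {}} = {}"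
      proof (intro ballI impI, rule ccontr)
        fix e e' assume e: "e \<in> N" "e' \<in> N" "e \<noteq> e'"
          and "{f \<in> C_edges v. f \<inter> e \<noteq> {}} \<inter> {f \<in> C_edges v. f \<inter> e' \<noteq> {}} \<noteq> {}"
        then obtain f where f: "f \<in> C_edges v" "f \<inter> e \<noteq> {}" "f \<inter> e' \<noteq> {}" by auto
        obtain w where "f = {v, w}" using other[OF f(1)] by auto
        moreover have "v \<notin> e" "v \<notin> e'" using vC e N by (auto simp: C_def)
        ultimately have "w \<in> e \<inter> e'" using f by auto
        then show False using M_disjoint[of e e'] e N by auto
      qed
    qed
    also have "(\<Union>e\<in>N. {f \<in> C_edges v. f \<inter> e \<noteq> {}}) = {f \<in> C_edges v. f \<inter> \<Union>N \<noteq> {}}" by auto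
    finally show ?thesis by simp
  qed
  have total: "(\<Sum>e\<in>M \<inter> EH. ?c e) = card (C_edges v)"
    using sum_c[of "M \<inter> EH"] by (simp add: C_edges_def flip: C_def)
  have "{f \<in> C_edges v. f \<inter> \<Union>S \<noteq> {}} = C_edges v - alive S v" "alive S v \<subseteq> C_edges v"
    by (auto simp: alive_def)
  then have "real (card {f \<in> C_edges v. f \<inter> \<Union>S \<noteq> {}}) = card (C_edges v) - real (card (alive S v))"
    using finite_C_edges by (simp add: card_Diff_subset finite_subset card_mono of_nat_diff)
  then have "real (card (alive S v)) = card (C_edges v) - (\<Sum>e\<in>S. ?c e)"
    using sum_c[OF S] by simp
  moreover have "(\<Sum>e\<in>S. ?c e) = (\<Sum>e\<in>M \<inter> EH. ?c e * of_bool (e \<in> S))"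
    using S finite_M by (simp add: sum.If_cases of_bool_def Int_absorb1 if_distrib cong: if_cong)
  ultimately show "real (card (alive S v)) - card (C_edges v) / 3
    = - (\<Sum>e\<in>M \<inter> EH. ?c e * (of_bool (e \<in> S) - 2 / 3))"
    by (simp add: right_diff_distrib sum_subtractf total flip: sum_distrib_right sum_divide_distrib)
  have "(?c e)\<^sup>2 \<le> 2 * ?c e" if e: "e \<in> M \<inter> EH" for e
  proof -
    have "{f \<in> C_edges v. f \<inter> e \<noteq> {}} \<subseteq> (\<lambda>w. {v, w}) ` e"
    proof
      fix f assume f: "f \<in> {f \<in> C_edges v. f \<inter> e \<noteq> {}}"
      then obtain w where "f = {v, w}" using other by auto
      moreover have "v \<notin> e" using vC e by (auto simp: C_def)
      ultimately show "f \<in> (\<lambda>w. {v, w}) ` e" using f by auto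
    qed
    then have "card {f \<in> C_edges v. f \<inter> e \<noteq> {}} \<le> card e"
      using e M_subset finite_edge by (intro surj_card_le) auto
    then have "?c e \<le> 2" using e M_subset card_edge d by auto
    then show ?thesis by (simp add: power2_eq_square mult_right_mono)
  qed
  then have "(\<Sum>e\<in>M \<inter> EH. (?c e)\<^sup>2) \<le> (\<Sum>e\<in>M \<inter> EH. 2 * ?c e)" by (intro sum_mono)
  also have "\<dots> = 2 * real (card (C_edges v))" using total by (simp flip: sum_distrib_left)
  also have "\<dots> \<le> 2 * D v"
    unfolding D_eq C_edges_def using finite_EH by (simp add: card_mono subset_iff)
  finally show "(\<Sum>e\<in>M \<inter> EH. (?c e)\<^sup>2) \<le> 2 * D v" .
qed

text \<open>An edge disjoint from \<open>C\<close> gets \<open>2 / 3 * \<rho> v\<close> from each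
  end \<open>v\<close> in \<open>A\<close>. An alive edge gets up to three times as much, reduced so
  that the alive edges at \<open>v\<close> carry in total no more than
  \<open>2 / 3 * \<rho> v\<close> for each edge of \<open>C_edges v\<close>. This is a fractional
  matching for every \<open>S\<close>; only the value depends on the choice.\<close>

lemma exists_restricted_of_subset:
  fixes \<epsilon> :: real
  assumes d: "d = 2" and S: "S \<subseteq> M \<inter> EH" and \<epsilon>: "\<epsilon> < 1" "3 / \<beta> \<le> \<epsilon>"
  shows "\<exists>y. fractional_matching V EH y \<and> restricted \<epsilon> EH y \<and>
    fm_value EH y = card S + (\<Sum>v\<in>A. 2 / 3 * \<rho> v * (D v - card (C_edges v))
      + 2 * \<rho> v * min (card (alive S v)) (card (C_edges v) / 3))"
proof -
  \<comment> \<open>The minimum caps the total of the alive edges at the level of their expected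
    number. Without alive edges the quotient is 0 by convention, but then \<open>q v\<close> enters
    no edge.\<close>
  define q where "q v = 2 * \<rho> v * min 1 (card (C_edges v) / 3 / card (alive S v))" for v
  define y where "y f = (if f \<in> S then 1 else if f \<inter> C = {} then \<Sum>v\<in>f \<inter> A. 2 / 3 * \<rho> v
    else if f \<inter> \<Union>S = {} then \<Sum>v\<in>f \<inter> A. q v else 0)" for f
  define F0 where "F0 v = {f \<in> EH. v \<in> f \<and> f \<inter> C = {}}" for v
  have SC: "\<Union>S \<subseteq> C" using S by (auto simp: C_def)
  have S_edge: "f \<in> EH" "f \<noteq> {}" "f \<inter> C = f" "f \<inter> \<Union>S = f" if "f \<in> S" for f
  proof -
    show "f \<in> EH" using S that by auto
    then show "f \<noteq> {}" using EH_subset edge_nonempty by blast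
    show "f \<inter> C = f" "f \<inter> \<Union>S = f" using that SC by auto
  qed
  have card2: "card f = 2" "finite f" if "f \<in> EH" for f
    using that EH_subset card_edge finite_edge d by auto
  have q: "0 \<le> q v" "q v \<le> 2 * \<rho> v" for v
    using \<rho>_bounds[of v] by (auto simp: q_def intro!: mult_left_le)
  have alive_q: "card (alive S v) * q v = 2 * \<rho> v * min (card (alive S v)) (card (C_edges v) / 3)" for v
    by (cases "card (alive S v) = 0") (auto simp: q_def min_def field_simps)
  have fin_alive: "finite (alive S v)" for v
    using finite_C_edges by (simp add: alive_def)
  have y_le: "0 \<le> y f" "y f \<le> (\<Sum>v\<in>f \<inter> A. 2 * \<rho> v)" if "f \<notin> S" for f
    using that q \<rho>_bounds(1) by (auto simp: y_def intro!: sum_nonneg sum_mono)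
  have A_other: "f \<inter> A - {u} = f \<inter> A" if "u \<notin> A" for f u
    using that by auto
  have y_\<epsilon>: "y f \<le> \<epsilon>" if f: "f \<in> EH" "f \<notin> S" for f
  proof (cases "f \<inter> C = {}")
    case True
    have "y f = 2 / 3 * (\<Sum>v\<in>f \<inter> A. \<rho> v)"
      using True f by (simp add: y_def sum_distrib_left)
    also have "(\<Sum>v\<in>f \<inter> A. \<rho> v) \<le> (\<Sum>v\<in>f. \<rho> v)"
      using card2[OF f(1)] \<rho>_bounds by (intro sum_mono2) auto
    also have "\<dots> \<le> (\<Sum>v\<in>f. 1 / 2 * (3 / \<beta>))"
    proof (rule sum_mono)
      show "\<rho> v \<le> 1 / 2 * (3 / \<beta>)" for v using \<rho>_bounds(2)[of v] by linarith
    qed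
    also have "\<dots> = 3 / \<beta>" using card2[OF f(1)] by simp
    finally have "y f \<le> 2 / 3 * (3 / \<beta>)" by simp
    also have "\<dots> \<le> 3 / \<beta>" using \<beta>_pos by (simp add: field_simps)
    finally show ?thesis using \<epsilon> by linarith
  next
    case False
    then obtain w where w: "w \<in> f" "w \<in> C" by auto
    then have "w \<notin> A" using A_C_disjoint by auto
    have "card (f - {w}) = 1" using card2[OF f(1)] w by simp
    then obtain v where v: "f - {w} = {v}" by (auto simp: card_1_singleton_iff)
    have "y f \<le> (\<Sum>v\<in>f \<inter> A. 2 * \<rho> v)" using y_le f by auto
    also have "\<dots> \<le> (\<Sum>v\<in>f - {w}. 2 * \<rho> v)"
      using card2[OF f(1)] \<rho>_bounds \<open>w \<notin> A\<close> by (intro sum_mono2) auto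
    also have "\<dots> \<le> 3 / \<beta>" using v \<rho>_bounds(2) by simp
    finally show ?thesis using \<epsilon> by linarith
  qed
  have y_1: "y f = 1" if "f \<in> S" for f using that by (simp add: y_def)
  have load: "(\<Sum>f | f \<in> EH \<and> u \<in> f. y f) \<le> 1" for u
  proof (cases "u \<in> \<Union>S")
    case True
    then obtain e where e: "e \<in> S" "u \<in> e" by auto
    show ?thesis
    proof (rule load_le_1_if_unit_edge[where y = y, OF S_edge(1)[OF e(1)] e(2) y_1[OF e(1)]])
      fix f assume f: "f \<in> EH" "u \<in> f" "f \<noteq> e"
      then have "f \<notin> S" using M_disjoint[of f e] S e by auto
      moreover have "u \<in> f \<inter> C" "u \<in> f \<inter> \<Union>S" using f SC e True by auto
      ultimately show "y f = 0" unfolding y_def by (metis empty_iff)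
    qed
  next
    case uS: False
    show ?thesis
    proof (cases "u \<in> A")
      case False
      show ?thesis
      proof (rule load_le_1)
        fix f assume f: "f \<in> EH" "u \<in> f"
        \<comment> \<open>Outside \<open>A\<close>, only the other end contributes, at most
          \<open>2 * \<rho> v\<close>, which by (P1) is within \<open>1 / D u\<close>.\<close>
        then have "y f \<le> 2 * (\<Sum>v\<in>f \<inter> A. \<rho> v)"
          using y_le uS by (auto simp: sum_distrib_left)
        also have "\<dots> \<le> 1 / D u"
          using sum_\<rho>_other_le[OF d f] by (simp add: A_other[OF False])
        finally show "y f \<le> 1 / D u" .
      qed
    next
      case uA: True
      then have uC: "u \<notin> C" using A_C_disjoint by auto
      have "y f \<le> 2 / 3 * \<rho> u + 1 / (3 * D u)" if f: "f \<in> F0 u" for f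
      proof -
        have f': "f \<in> EH" "u \<in> f" "f \<inter> C = {}" "f \<notin> S" using f S_edge by (auto simp: F0_def)
        have "y f = 2 / 3 * (\<Sum>v\<in>f \<inter> A. \<rho> v)" using f' by (simp add: y_def sum_distrib_left)
        also have "(\<Sum>v\<in>f \<inter> A. \<rho> v) = \<rho> u + (\<Sum>v\<in>f \<inter> A - {u}. \<rho> v)"
          using f' uA card2 by (intro sum.remove) auto
        also have "\<dots> \<le> \<rho> u + 1 / (2 * D u)"
          using sum_\<rho>_other_le[OF d f'(1,2)] by simp
        finally show ?thesis by simp
      qed
      then have "(\<Sum>f\<in>F0 u. y f) \<le> (\<Sum>f\<in>F0 u. 2 / 3 * \<rho> u + 1 / (3 * D u))"
        by (intro sum_mono)
      also have "\<dots> = card (F0 u) * (2 / 3 * \<rho> u) + card (F0 u) * (1 / (3 * D u))"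
        by (simp add: distrib_left)
      also have "card (F0 u) * (1 / (3 * D u)) \<le> 1 / 3"
      proof -
        have "card (F0 u) \<le> D u"
          unfolding D_eq F0_def using finite_EH by (simp add: card_mono subset_iff)
        then show ?thesis using D_nonneg[of u] by (cases "D u = 0") (auto simp: field_simps)
      qed
      finally have 0: "(\<Sum>f\<in>F0 u. y f) \<le> card (F0 u) * (2 / 3 * \<rho> u) + 1 / 3" by simp
      have "(\<Sum>f\<in>C_edges u. y f) = (\<Sum>f\<in>alive S u. y f)"
      proof (rule sum.mono_neutral_right)
        show "\<forall>f\<in>C_edges u - alive S u. y f = 0"
          using uS by (auto simp: C_edges_def alive_def y_def)
      qed (auto simp: finite_C_edges alive_def)
      also have "\<dots> = (\<Sum>f\<in>alive S u. q u)"
      proof (rule sum.cong)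
        fix f assume f: "f \<in> alive S u"
        then have f': "f \<in> EH" "u \<in> f" "f \<inter> C \<noteq> {}" "f \<inter> \<Union>S = {}" "f \<notin> S"
          using uS by (auto simp: alive_def C_edges_def)
        obtain w where w: "w \<in> f" "w \<in> C" using f' by auto
        have "f = {u, w}"
          using card2[OF f'(1)] f'(2) w uC by (auto simp: card_2_iff)
        then have "f \<inter> A = {u}" using uA w A_C_disjoint by auto
        then show "y f = q u" using f' by (simp add: y_def)
      qed simp
      also have "\<dots> = 2 * \<rho> u * min (card (alive S u)) (card (C_edges u) / 3)"
        using alive_q by simp
      also have "\<dots> \<le> 2 * \<rho> u * (card (C_edges u) / 3)"
        using \<rho>_bounds(1) by (intro mult_left_mono) auto
      finally have 1: "(\<Sum>f\<in>C_edges u. y f) \<le> card (C_edges u) * (2 / 3 * \<rho> u)"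
        by (simp add: mult_ac)
      have part: "{f. f \<in> EH \<and> u \<in> f} = F0 u \<union> C_edges u" "F0 u \<inter> C_edges u = {}"
        by (auto simp: F0_def C_edges_def)
      have fin: "finite (F0 u)" using finite_EH by (simp add: F0_def)
      have "D u = card (F0 u) + card (C_edges u)"
        unfolding D_eq part(1) using part(2) fin finite_C_edges by (simp add: card_Un_disjoint)
      moreover have "(\<Sum>f | f \<in> EH \<and> u \<in> f. y f) = (\<Sum>f\<in>F0 u. y f) + (\<Sum>f\<in>C_edges u. y f)"
        unfolding part(1) using part(2) fin finite_C_edges by (intro sum.union_disjoint)
      \<comment> \<open>The load is at most \<open>2 / 3 * \<rho> u * D u + 1 / 3\<close>, where
        \<open>1 / 3\<close> covers the contributions of the other ends in \<open>A\<close>.\<close>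
      ultimately show ?thesis
        using 0 1 \<rho>_bounds(3)[of u] by (simp add: algebra_simps)
    qed
  qed
  have "fractional_matching V EH y"
    unfolding fractional_matching_def
  proof (intro conjI ballI)
    fix f assume "f \<in> EH"
    then show "y f \<in> {0..1}" using y_le(1) y_\<epsilon>[of f] y_1[of f] \<epsilon> by (cases "f \<in> S") auto
  qed (rule load)
  moreover have "restricted \<epsilon> EH y"
    unfolding restricted_def using y_le y_\<epsilon> y_1 by auto
  moreover have "fm_value EH y = card S + (\<Sum>v\<in>A. 2 / 3 * \<rho> v * (D v - card (C_edges v))
      + 2 * \<rho> v * min (card (alive S v)) (card (C_edges v) / 3))"
  proof -
    let ?g = "\<lambda>f v. if f \<inter> C = {} then 2 / 3 * \<rho> v else if f \<inter> \<Union>S = {} then q v else 0"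
    have "fm_value EH y = (\<Sum>f\<in>EH. of_bool (f \<in> S) + (\<Sum>v\<in>f \<inter> A. ?g f v))"
      unfolding fm_value_def
    proof (rule sum.cong)
      fix f assume "f \<in> EH"
      show "y f = of_bool (f \<in> S) + (\<Sum>v\<in>f \<inter> A. ?g f v)"
      proof (cases "f \<in> S")
        case True
        then show ?thesis using S_edge[OF True] by (simp add: y_def)
      qed (simp add: y_def)
    qed simp
    also have "\<dots> = card S + (\<Sum>f\<in>EH. \<Sum>v\<in>f \<inter> A. ?g f v)"
      using S finite_EH by (simp add: sum.distrib Int_absorb1)
    also have "(\<Sum>f\<in>EH. \<Sum>v\<in>f \<inter> A. ?g f v) = (\<Sum>v\<in>A. \<Sum>f | f \<in> EH \<and> v \<in> f. ?g f v)"
      using finite_EH finite_A by (rule sum_incidence_swap)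
    also have "\<dots> = (\<Sum>v\<in>A. 2 / 3 * \<rho> v * (D v - card (C_edges v))
      + 2 * \<rho> v * min (card (alive S v)) (card (C_edges v) / 3))"
    proof (rule sum.cong)
      fix v
      have part: "{f. f \<in> EH \<and> v \<in> f} = F0 v \<union> C_edges v" "F0 v \<inter> C_edges v = {}"
        by (auto simp: F0_def C_edges_def)
      have fin: "finite (F0 v)" using finite_EH by (simp add: F0_def)
      have D: "D v = card (F0 v) + card (C_edges v)"
        unfolding D_eq part(1) using part(2) fin finite_C_edges by (simp add: card_Un_disjoint)
      have "(\<Sum>f | f \<in> EH \<and> v \<in> f. ?g f v) = (\<Sum>f\<in>F0 v. ?g f v) + (\<Sum>f\<in>C_edges v. ?g f v)"
        unfolding part(1) using part(2) fin finite_C_edges by (intro sum.union_disjoint)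
      also have "(\<Sum>f\<in>F0 v. ?g f v) = (\<Sum>f\<in>F0 v. 2 / 3 * \<rho> v)"
        by (intro sum.cong) (auto simp: F0_def)
      also have "(\<Sum>f\<in>C_edges v. ?g f v) = (\<Sum>f\<in>C_edges v. if f \<inter> \<Union>S = {} then q v else 0)"
        by (intro sum.cong) (auto simp: C_edges_def)
      also have "\<dots> = card (alive S v) * q v"
        using finite_C_edges by (simp add: sum.If_cases alive_def Int_def)
      finally show "(\<Sum>f | f \<in> EH \<and> v \<in> f. ?g f v) = 2 / 3 * \<rho> v * (D v - card (C_edges v))
        + 2 * \<rho> v * min (card (alive S v)) (card (C_edges v) / 3)"
        by (simp add: alive_q D)
    qed simp
    finally show ?thesis .
  qed
  ultimately show ?thesis by blast
qed

text \<open>The expected size of \<open>S\<close> is \<open>2 / 3 * card (M \<inter> EH)\<close>,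
  and the vertices of \<open>A\<close> yield almost \<open>2 / 3 * card (M - EH)\<close>; for
  \<open>d = 2\<close> the ratio to be reached is \<open>2 / 3\<close>. It remains to bound the
  cut-off.\<close>

lemma exists_restricted_uniformity_2:
  fixes \<epsilon> :: real
  assumes d: "d = 2" and \<epsilon>: "0 < \<epsilon>" "\<epsilon> < 1" and lam: "lam = \<epsilon> / 6"
    and \<beta>: "\<beta> \<ge> 8 * (real d)^2 / (real d - 1) * lam powi (-3)"
  shows "\<exists>y. fractional_matching V EH y \<and> restricted \<epsilon> EH y \<and>
    fm_value EH y \<ge> real (card M) * (real d / ((real d)^2 - real d + 1) - \<epsilon> / (real d - 1))"
proof -
  \<comment> \<open>This makes the linear part of the cut-off loss at most
    \<open>3 / \<beta> * t = \<epsilon> / 8\<close>. The variance part is at most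
    \<open>8 / (\<epsilon> * \<beta>)\<close>, which is no larger once
    \<open>\<epsilon>\<^sup>2 * \<beta> \<ge> 64\<close>.\<close>
  define t where "t = \<epsilon> * \<beta> / 24"
  have t: "t > 0" using \<epsilon> \<beta>_pos by (simp add: t_def)
  have "lam powi (-3) = 216 / \<epsilon> ^ 3"
    by (simp add: lam power_int_minus field_simps)
  then have "\<beta> \<ge> 6912 / \<epsilon> ^ 3" using \<beta> d by simp
  moreover have "6912 / \<epsilon>\<^sup>2 \<le> 6912 / \<epsilon> ^ 3"
    using \<epsilon> power_decreasing[of 2 3 \<epsilon>] by (intro divide_left_mono) auto
  ultimately have "\<beta> \<ge> 6912 / \<epsilon>\<^sup>2" by linarith
  then have \<beta>_\<epsilon>: "6912 \<le> \<epsilon>\<^sup>2 * \<beta>" using \<epsilon> by (simp add: field_simps)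
  also have "\<dots> \<le> \<epsilon> * \<beta>"
    using \<epsilon> \<beta>_pos power_decreasing[of 1 2 \<epsilon>] by (intro mult_right_mono) auto
  finally have "3 / \<beta> \<le> \<epsilon>" using \<beta>_pos by (simp add: field_simps)
  define c where "c v e = real (card {f \<in> C_edges v. f \<inter> e \<noteq> {}})" for v e
  define dev where "dev S v = real (card (alive S v)) - card (C_edges v) / 3" for S v
  let ?w = "\<lambda>v. 2 * \<rho> v / (4 * t)"
  \<comment> \<open>A cost is bounded from above here, so the gain \<open>card S\<close> enters with
    coefficient \<open>-1\<close>.\<close>
  obtain S where S: "S \<subseteq> M \<inter> EH" and
    S_le: "(\<Sum>e\<in>S. -1) + (\<Sum>v\<in>A. ?w v * (0 + (\<Sum>e\<in>M \<inter> EH. c v e * (of_bool (e \<in> S) - 2 / 3)))\<^sup>2)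
      \<le> 2 / 3 * (\<Sum>e\<in>M \<inter> EH. -1)
        + (\<Sum>v\<in>A. ?w v * (0\<^sup>2 + 2 / 3 * (1 - 2 / 3) * (\<Sum>e\<in>M \<inter> EH. (c v e)\<^sup>2)))"
    using exists_subset_le_expectation[of "M \<inter> EH" A "2 / 3" "\<lambda>_. -1" ?w "\<lambda>_. 0" c] finite_M finite_A
    by auto
  \<comment> \<open>The right-hand side is \<open>\<epsilon> / 4\<close>, so the two ends of an edge
    of \<open>M - EH\<close> lose at most \<open>\<epsilon> / 2\<close> together.\<close>
  have loss: "?w v * (2 / 9 * (\<Sum>e\<in>M \<inter> EH. (c v e)\<^sup>2)) + 2 * \<rho> v * t \<le> 3 / 8 * \<epsilon> * (2 / 3)"
    if v: "v \<in> A" for v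
  proof -
    have "(\<Sum>e\<in>M \<inter> EH. (c v e)\<^sup>2) \<le> 2 * D v"
      using card_alive_deviation(2)[OF d v S] by (simp add: c_def)
    also have "D v \<le> \<beta>" by (rule D_le_\<beta>)
    finally have "?w v * (2 / 9 * (\<Sum>e\<in>M \<inter> EH. (c v e)\<^sup>2)) + 2 * \<rho> v * t
        \<le> ?w v * (2 / 9 * (2 * \<beta>)) + 2 * \<rho> v * t"
      using \<rho>_bounds(1) t by (intro add_right_mono mult_left_mono) auto
    also have "\<dots> = 2 * \<rho> v * (\<beta> / (9 * t) + t)"
      by (simp add: field_simps)
    also have "\<dots> \<le> 3 / \<beta> * (\<beta> / (9 * t) + t)"
      using \<rho>_bounds(2) t \<beta>_pos by (intro mult_right_mono) auto
    also have "\<dots> = 8 / (\<epsilon> * \<beta>) + \<epsilon> / 8"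
      using \<epsilon> \<beta>_pos by (simp add: t_def field_simps)
    also have "8 / (\<epsilon> * \<beta>) \<le> \<epsilon> / 8"
      using \<beta>_\<epsilon> \<epsilon> \<beta>_pos by (simp add: field_simps power2_eq_square)
    finally show ?thesis by simp
  qed
  have card_A: "card A = 2 * card (M - EH)"
    using card_Union_matching[of "M - EH"] d by (simp add: A_def)
  have "(\<Sum>v\<in>A. ?w v * (2 / 9 * (\<Sum>e\<in>M \<inter> EH. (c v e)\<^sup>2)) + 2 * \<rho> v * t) \<le> (\<Sum>v\<in>A. 3 / 8 * \<epsilon> * (2 / 3))"
    using loss by (intro sum_mono)
  then have total_loss: "(\<Sum>v\<in>A. ?w v * (2 / 9 * (\<Sum>e\<in>M \<inter> EH. (c v e)\<^sup>2))) + (\<Sum>v\<in>A. 2 * \<rho> v * t)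
      \<le> \<epsilon> / 2 * card (M - EH)"
    by (simp add: sum.distrib card_A)
  have dev: "(\<Sum>v\<in>A. ?w v * (dev S v)\<^sup>2)
      \<le> card S - 2 / 3 * card (M \<inter> EH) + (\<Sum>v\<in>A. ?w v * (2 / 9 * (\<Sum>e\<in>M \<inter> EH. (c v e)\<^sup>2)))"
  proof -
    have "(\<Sum>v\<in>A. ?w v * (dev S v)\<^sup>2)
        = (\<Sum>v\<in>A. ?w v * (0 + (\<Sum>e\<in>M \<inter> EH. c v e * (of_bool (e \<in> S) - 2 / 3)))\<^sup>2)"
      using card_alive_deviation(1)[OF d _ S] by (intro sum.cong) (simp_all add: dev_def c_def)
    then show ?thesis using S_le by simp
  qed
  obtain y where y: "fractional_matching V EH y" "restricted \<epsilon> EH y" and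
    val: "fm_value EH y = card S + (\<Sum>v\<in>A. 2 / 3 * \<rho> v * (D v - card (C_edges v))
      + 2 * \<rho> v * min (card (alive S v)) (card (C_edges v) / 3))"
    using exists_restricted_of_subset[OF d S \<epsilon>(2) \<open>3 / \<beta> \<le> \<epsilon>\<close>] by blast
  have "(\<Sum>v\<in>A. 2 / 3 * (\<rho> v * D v) - (?w v * (dev S v)\<^sup>2 + 2 * \<rho> v * t))
      \<le> (\<Sum>v\<in>A. 2 / 3 * \<rho> v * (D v - card (C_edges v))
      + 2 * \<rho> v * min (card (alive S v)) (card (C_edges v) / 3))"
  proof (rule sum_mono)
    fix v
    have "2 * \<rho> v * (card (C_edges v) / 3 - ((dev S v)\<^sup>2 / (4 * t) + t))
        \<le> 2 * \<rho> v * min (card (alive S v)) (card (C_edges v) / 3)"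
      unfolding dev_def using \<rho>_bounds(1) by (intro mult_left_mono min_quadratic_lower_bound t) auto
    moreover have "2 / 3 * (\<rho> v * D v) - (?w v * (dev S v)\<^sup>2 + 2 * \<rho> v * t)
      = 2 / 3 * \<rho> v * (D v - card (C_edges v))
        + 2 * \<rho> v * (card (C_edges v) / 3 - ((dev S v)\<^sup>2 / (4 * t) + t))"
      using t by (simp add: field_simps)
    ultimately show "2 / 3 * (\<rho> v * D v) - (?w v * (dev S v)\<^sup>2 + 2 * \<rho> v * t)
      \<le> 2 / 3 * \<rho> v * (D v - card (C_edges v))
      + 2 * \<rho> v * min (card (alive S v)) (card (C_edges v) / 3)"
      by linarith
  qed
  then have "fm_value EH y \<ge> card S + 2 / 3 * (\<Sum>v\<in>A. \<rho> v * D v)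
      - (\<Sum>v\<in>A. ?w v * (dev S v)\<^sup>2) - (\<Sum>v\<in>A. 2 * \<rho> v * t)"
    unfolding val sum_subtractf sum.distrib sum_distrib_left by linarith
  moreover have "(\<Sum>v\<in>A. \<rho> v * D v) \<ge> card (M - EH) - \<epsilon> / 3 * card (M - EH)"
    using sum_A_\<rho>_D[OF d] \<epsilon> by (simp add: lam algebra_simps)
  \<comment> \<open>The loss \<open>2 / 9 * \<epsilon>\<close> is \<open>2 / 3 * (2 * lam)\<close>
    from (P2), and \<open>\<epsilon> / 2\<close> is the cut-off.\<close>
  ultimately have "fm_value EH y \<ge> 2 / 3 * card M - (2 / 9 * \<epsilon> + \<epsilon> / 2) * card (M - EH)"
    using dev total_loss by (simp add: card_M algebra_simps)
  moreover have "(2 / 9 * \<epsilon> + \<epsilon> / 2) * card (M - EH) \<le> \<epsilon> * card M"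
    using \<epsilon> card_M by (intro mult_mono) auto
  ultimately have "fm_value EH y \<ge> card M * (2 / 3 - \<epsilon>)"
    by (simp add: algebra_simps)
  then show ?thesis using y d by auto
qed

end

section \<open>Application to a maximum matching\<close>

theorem theorem6p4:
  fixes V :: "'a set" and E EH :: "'a set set" and d :: nat and \<epsilon> lam \<beta> :: real
  assumes "d \<ge> 2"
    and "uniform_hypergraph d V E"
    and "0 < \<epsilon>" and "\<epsilon> < 1"
    and "lam = \<epsilon> / 6"
    and "\<beta> \<ge> 8 * (real d)^2 / (real d - 1) * lam powi (-3)"
    and "hedcs E \<beta> (\<beta> * (1 - lam)) EH"
  shows "\<exists>y. fractional_matching V EH y \<and> restricted \<epsilon> EH y \<and>
           fm_value EH y \<ge> real (matching_number E) *
             (real d / ((real d)^2 - real d + 1) - \<epsilon> / (real d - 1))"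
proof -
  have "finite E"
    using assms(2) by (auto simp: uniform_hypergraph_def hypergraph_def intro: finite_subset)
  then have "finite {card M | M. hmatching E M}"
    by (auto simp: hmatching_def)
  moreover have "{card M | M. hmatching E M} \<noteq> {}"
    by (auto simp: hmatching_def disjoint_def)
  ultimately have "matching_number E \<in> {card M | M. hmatching E M}"
    unfolding matching_number_def by (rule Max_in)
  then obtain M where M: "hmatching E M" "card M = matching_number E" by auto
  \<comment> \<open>The degree conditions alone would allow \<open>\<beta> = 0\<close>; positivity
    comes from the assumed lower bound.\<close>
  have "8 * (real d)^2 / (real d - 1) * lam powi (-3) > 0"
    using assms(1,3,5) by (intro mult_pos_pos divide_pos_pos zero_less_power_int) auto
  then have "\<beta> > 0" using assms(6) by linarith
  then interpret hedcs_with_matching V E EH M d \<beta> lam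
    using assms M by unfold_locales auto
  show ?thesis
  proof (cases "d = 2")
    case True
    then show ?thesis
      using exists_restricted_uniformity_2[OF True assms(3-6)] M by simp
  next
    case False
    then show ?thesis
      using exists_restricted_uniformity_ge_3[OF _ assms(3-6)] assms(1) M by simp
  qed
qed

end
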